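(* Let $\mathcal{X}$ be a locally compact Polish space and $\mathcal{H}$ a separable Hilbert space. Let $X=(X_n)_{n\ge1}$ be an $\mathcal{X}$-valued process, and assume that $X$ is empirically weakly converging (EWC) in probability (resp. almost surely) with limit measure $P$. Then, for all $\phi\in C_{\mathrm b}(\mathcal{X};\mathcal{H})$, $$\lim_{n\to\infty}\eta_n^X\phi = P\phi \quad\text{in } \mathcal{H},$$ where the convergence is in probability (resp. almost sure).
   Context: All random variables are defined on a complete standard Borel probability space $(\Omega,\mathcal{A},\mathbb{P})$. Polish spaces carry their Borel $\sigma$-algebra. $\mathcal{P}(\mathcal{X})$ is the set of Borel probability measures on $\mathcal{X}$ with the topology of weak convergence (which is metrizable). A random measure on $\mathcal{X}$ is a measurable map $P:\Omega\to\mathcal{P}(\mathcal{X})$. $C_{\mathrm b}(\mathcal{X};\mathcal{H})$ is the set of continuous bounded functions from $\mathcal{X}$ to $\mathcal{H}$, and $P\phi:=\int_{\mathcal{X}}\phi\,\mathrm{d}P$ (Bochner integral). The empirical measure of a process $X$ is $\eta_n^X=\frac1n\sum_{i=1}^n\delta_{X_i}$, so $\eta_n^X\phi=\frac1n\sum_{i=1}^n\phi(X_i)$. Convergence in $\mathcal{H}$ is with respect to its norm. Definition (EWC): let $d$ be a metric on $\mathcal{P}(\mathcal{X})$ that metrizes weak convergence. An $\mathcal{X}$-valued process $X$ is EWC in probability (resp. almost surely) if there exists a random measure $P$ on $\mathcal{X}$ such that $\lim_{n\to\infty}d(\eta_n^X,P)=0$ in probability (resp. almost surely); $P$ is then called a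 limit measure of $X$. *)

theory Defs
  imports "HOL-Probability.Probability"
begin

definition borel_of :: "'a topology \<Rightarrow> 'a measure" where
  "borel_of T = sigma (topspace T) {U. openin T U}"

text \<open>
  A complete standard Borel probability space: the completion of a probability space whose
  sigma-algebra is the Borel sigma-algebra of some Polish topology on the sample space.
\<close>

definition complete_standard_borel_prob_space :: "'w measure \<Rightarrow> bool" where
  "complete_standard_borel_prob_space M \<longleftrightarrow>
     (\<exists>N T. prob_space N \<and> completely_metrizable_space T \<and> second_countable T \<and>
            sets N = sets (borel_of T) \<and> M = completion N)"

definition borel_probs :: "'x::topological_space measure set" where
  "borel_probs = {\<mu>. sets \<mu> = sets borel \<and> prob_space \<mu>}"

text \<open>
  The coarsest topology on the Borel probability measures for which \<open>\<mu> \<mapsto> \<integral> f d\<mu>\<close> is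
  continuous for every bounded continuous real function \<open>f\<close>.
\<close>

definition weak_topology :: "'x::topological_space measure topology" where
  "weak_topology = topology_generated_by
     {{\<mu> \<in> borel_probs. (\<integral>x. f x \<partial>\<mu>) \<in> U} | (f :: 'x \<Rightarrow> real) U. f \<in> bcontfun \<and> open U}"

definition metrizes_weak_convergence ::
    "('x::topological_space measure \<Rightarrow> 'x measure \<Rightarrow> real) \<Rightarrow> bool" where
  "metrizes_weak_convergence d \<longleftrightarrow>
     Metric_space borel_probs d \<and> Metric_space.mtopology borel_probs d = weak_topology"

definition random_measure :: "'w measure \<Rightarrow> ('w \<Rightarrow> 'x::topological_space measure) \<Rightarrow> bool" where
  "random_measure M P \<longleftrightarrow> P \<in> M \<rightarrow>\<^sub>M borel_of weak_topology"

text \<open>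
  The measure \<open>(1/n) (\<delta>\<^bsub>x 1\<^esub> + \<dots> + \<delta>\<^bsub>x n\<^esub>)\<close>, where \<open>return borel a\<close> is the
  Dirac measure at \<open>a\<close>. It is meaningful for \<open>n \<ge> 1\<close> only.
\<close>

definition empirical_measure :: "nat \<Rightarrow> (nat \<Rightarrow> 'x::topological_space) \<Rightarrow> 'x measure" where
  "empirical_measure n x = measure_of UNIV (sets borel)
     (\<lambda>A. (\<Sum>i=1..n. emeasure (return borel (x i)) A) / of_nat n)"

text \<open>
  Convergence in probability of a sequence of random variables indexed by \<open>n \<ge> 1\<close>.
  Measurability is part of the notion, since \<open>measure M\<close> is \<open>0\<close> on non-measurable sets.
\<close>

definition converges_in_prob ::
    "'w measure \<Rightarrow> (nat \<Rightarrow> 'w \<Rightarrow> 'b::{metric_space, second_countable_topology}) \<Rightarrow> ('w \<Rightarrow> 'b) \<Rightarrow> bool"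
  where
  "converges_in_prob M Z Y \<longleftrightarrow>
     (\<forall>n\<ge>1. Z n \<in> borel_measurable M) \<and> Y \<in> borel_measurable M \<and>
     (\<forall>\<epsilon>>0. (\<lambda>n. measure M {\<omega> \<in> space M. dist (Z n \<omega>) (Y \<omega>) > \<epsilon>}) \<longlonglongrightarrow> 0)"

text \<open>
  \<open>X\<close> is EWC in probability (almost surely) if it has a limit measure in the following sense.
  For a process \<open>X\<close> and a random measure \<open>P\<close>, the measurability of
  \<open>\<omega> \<mapsto> d (\<eta>\<^sub>n \<omega>) (P \<omega>)\<close> that \<open>converges_in_prob\<close> asks for holds automatically when the
  underlying space is Polish, because the weak topology is then separable and metrized by \<open>d\<close>.
\<close>

definition limit_measure_in_prob ::
    "'w measure \<Rightarrow> ('x::topological_space measure \<Rightarrow> 'x measure \<Rightarrow> real) \<Rightarrow>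
     (nat \<Rightarrow> 'w \<Rightarrow> 'x) \<Rightarrow> ('w \<Rightarrow> 'x measure) \<Rightarrow> bool" where
  "limit_measure_in_prob M d X P \<longleftrightarrow> random_measure M P \<and>
     converges_in_prob M (\<lambda>n \<omega>. d (empirical_measure n (\<lambda>i. X i \<omega>)) (P \<omega>)) (\<lambda>_. 0)"

definition limit_measure_AE ::
    "'w measure \<Rightarrow> ('x::topological_space measure \<Rightarrow> 'x measure \<Rightarrow> real) \<Rightarrow>
     (nat \<Rightarrow> 'w \<Rightarrow> 'x) \<Rightarrow> ('w \<Rightarrow> 'x measure) \<Rightarrow> bool" where
  "limit_measure_AE M d X P \<longleftrightarrow> random_measure M P \<and>
     (AE \<omega> in M. (\<lambda>n. d (empirical_measure n (\<lambda>i. X i \<omega>)) (P \<omega>)) \<longlonglongrightarrow> 0)"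

lemma space_empirical_measure [simp]: "space (empirical_measure n x) = UNIV"
  by (simp add: empirical_measure_def space_measure_of_conv)

lemma sets_empirical_measure [simp, measurable_cong]: "sets (empirical_measure n x) = sets borel"
  unfolding empirical_measure_def
  by (metis sets.sets_measure_of_eq space_borel)

lemma emeasure_empirical_measure:
  assumes "A \<in> sets borel"
  shows "emeasure (empirical_measure n x) A =
    (\<Sum>i=1..n. emeasure (return borel (x i)) A) / of_nat n"
proof (rule emeasure_measure_of[OF empirical_measure_def])
  show "countably_additive (sets (empirical_measure n x))
     (\<lambda>A. (\<Sum>i=1..n. emeasure (return borel (x i)) A) / of_nat n)"
  proof (rule countably_additiveI)
    fix B :: "nat \<Rightarrow> 'a set"
    assume B: "range B \<subseteq> sets (empirical_measure n x)" "disjoint_family B"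
    have "(\<Sum>j. (\<Sum>i=1..n. emeasure (return borel (x i)) (B j)) / of_nat n) =
          (\<Sum>i=1..n. \<Sum>j. emeasure (return borel (x i)) (B j)) / of_nat n"
      by (simp add: ennreal_suminf_divide suminf_sum)
    also have "(\<Sum>i=1..n. \<Sum>j. emeasure (return borel (x i)) (B j)) =
               (\<Sum>i=1..n. emeasure (return borel (x i)) (\<Union>j. B j))"
      using B by (intro sum.cong refl suminf_emeasure) auto
    finally show "(\<Sum>j. (\<Sum>i=1..n. emeasure (return borel (x i)) (B j)) / of_nat n) =
       (\<Sum>i=1..n. emeasure (return borel (x i)) (\<Union>j. B j)) / of_nat n" .
  qed
qed (use assms in \<open>auto simp: positive_def\<close>)

lemma empirical_measure_eq_distr:
  assumes "n \<ge> 1"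
  shows "empirical_measure n x = distr (uniform_count_measure {1..n}) borel x"
proof (rule measure_eqI)
  fix A assume "A \<in> sets (empirical_measure n x)"
  hence A: "A \<in> sets borel" by simp
  have "emeasure (distr (uniform_count_measure {1..n}) borel x) A =
        emeasure (uniform_count_measure {1..n}) (x -` A \<inter> {1..n})"
    using A by (subst emeasure_distr) (auto simp: measurable_def sets_uniform_count_measure
        space_uniform_count_measure)
  also have "\<dots> = of_nat (card (x -` A \<inter> {1..n})) / of_nat n"
    using assms by (subst emeasure_uniform_count_measure)
      (auto simp: divide_ennreal ennreal_of_nat_eq_real_of_nat)
  also have "of_nat (card (x -` A \<inter> {1..n})) = (\<Sum>i=1..n. emeasure (return borel (x i)) A)"
    using A by (simp add: indicator_def sum.If_cases Int_def conj_commute)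
  finally show "emeasure (empirical_measure n x) A =
      emeasure (distr (uniform_count_measure {1..n}) borel x) A"
    using A by (simp add: emeasure_empirical_measure)
qed simp

lemma integral_empirical_measure:
  fixes f :: "'x::topological_space \<Rightarrow> 'b::{banach, second_countable_topology}"
  assumes "n \<ge> 1" "f \<in> borel_measurable borel"
  shows "(\<integral>y. f y \<partial>empirical_measure n x) = (1 / real n) *\<^sub>R (\<Sum>i=1..n. f (x i))"
proof -
  have "(\<integral>y. f y \<partial>empirical_measure n x) = (\<integral>i. f (x i) \<partial>uniform_count_measure {1..n})"
    using assms by (subst empirical_measure_eq_distr, simp, subst integral_distr)
      (auto simp: measurable_def sets_uniform_count_measure space_uniform_count_measure)
  also have "\<dots> = (1 / real n) *\<^sub>R (\<Sum>i=1..n. f (x i))"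
    unfolding uniform_count_measure_def
    by (subst lebesgue_integral_point_measure_finite) (auto simp: scaleR_sum_right)
  finally show ?thesis .
qed

end

theory Submission
  imports Defs
begin

text \<open>
  Integration of a bounded continuous Banach-valued \<open>\<phi>\<close> is continuous for the weak topology. For a
  dense sequence \<open>h\<close>, the functions \<open>g\<^sub>j = max 0 (\<epsilon> - \<parallel>\<phi> - h\<^sub>j\<parallel>)\<close> give weights
  \<open>p\<^sub>j = g\<^sub>j / (\<delta> + \<Sum>\<^bsub>i<N\<^esub> g\<^sub>i)\<close> for which \<open>\<Sum>\<^bsub>j<N\<^esub> p\<^sub>j h\<^sub>j\<close> is within
  \<open>\<epsilon> + \<parallel>\<phi>\<parallel> r\<^sub>N\<close> of \<open>\<phi>\<close>, where \<open>r\<^sub>N = 1 - \<Sum>\<^bsub>j<N\<^esub> p\<^sub>j\<close>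
  is real, bounded and continuous, and tends to \<open>0\<close> pointwise when \<open>\<delta> = 1 / (N + 1)\<close>. Choosing
  \<open>N\<close> with \<open>\<integral> r\<^sub>N d\<mu>\<close> small controls \<open>\<integral> r\<^sub>N d\<mu>'\<close> for all \<open>\<mu>'\<close> weakly close
  to \<open>\<mu>\<close>, which takes the place of a tightness argument. Both modes of convergence then follow
  from the continuous mapping theorem, in probability by passing to almost surely convergent
  subsequences.
\<close>

section \<open>Bounded continuous functions, their finite-rank approximation and limits of their
  integrals\<close>

lemma bcontfun_borel_measurable:
  "f \<in> bcontfun \<Longrightarrow> f \<in> borel_measurable borel"
  by (auto simp: bcontfun_def intro: borel_measurable_continuous_onI)

lemma bcontfun_normE:
  fixes f :: "'x::topological_space \<Rightarrow> 'h::real_normed_vector"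
  assumes "f \<in> bcontfun"
  obtains C where "C > 0" "\<And>x. norm (f x) \<le> C"
  using assms unfolding bcontfun_def bounded_pos by auto

lemma integrable_bcontfun:
  fixes f :: "'x::topological_space \<Rightarrow> 'h::{banach, second_countable_topology}"
  assumes "f \<in> bcontfun" "\<mu> \<in> borel_probs"
  shows "integrable \<mu> f"
proof -
  interpret prob_space \<mu> using assms by (simp add: borel_probs_def)
  have "sets \<mu> = sets borel" using assms by (simp add: borel_probs_def)
  hence "f \<in> borel_measurable \<mu>"
    using bcontfun_borel_measurable[OF assms(1)] measurable_cong_sets by blast
  then show ?thesis
    by (metis AE_I2 assms(1) bcontfun_normE integrable_const_bound)
qed

text \<open>The range of \<open>\<phi>\<close> need not be relatively compact, so finitely many
  \<open>h j\<close> cannot approximate it uniformly. The weights \<open>p N j\<close> and the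
  remainder \<open>r N\<close> sum to 1, and \<open>r N\<close> measures how badly the first
  \<open>N\<close> points cover \<open>\<phi> x\<close>.\<close>

lemma bcontfun_finite_rank_approximation:
  fixes \<phi> :: "'x::topological_space \<Rightarrow> 'h::{real_normed_vector, second_countable_topology}"
  assumes \<phi>: "\<phi> \<in> bcontfun" and \<epsilon>: "\<epsilon> > 0"
  obtains h :: "nat \<Rightarrow> 'h" and p :: "nat \<Rightarrow> nat \<Rightarrow> 'x \<Rightarrow> real" and r :: "nat \<Rightarrow> 'x \<Rightarrow> real"
  where "\<And>N j. j < N \<Longrightarrow> p N j \<in> bcontfun" "\<And>N. r N \<in> bcontfun"
    "\<And>N x. 0 \<le> r N x" "\<And>N x. r N x \<le> 1" "\<And>x. (\<lambda>N. r N x) \<longlonglongrightarrow> 0"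
    "\<And>N x. norm (\<phi> x - (\<Sum>j<N. p N j x *\<^sub>R h j)) \<le> \<epsilon> + norm (\<phi> x) * r N x"
proof -
  obtain D :: "'h set" where D: "countable D" "\<And>U. open U \<Longrightarrow> U \<noteq> {} \<Longrightarrow> \<exists>d\<in>D. d \<in> U"
    by (erule countable_dense_setE)
  define h where "h = from_nat_into D"
  \<comment> \<open>A continuous bump that is positive exactly where \<open>\<phi>\<close> is within
    \<open>\<epsilon>\<close> of \<open>h j\<close>.\<close>
  define g where "g j x = max 0 (\<epsilon> - norm (\<phi> x - h j))" for j x
  \<comment> \<open>Positivity of \<open>\<delta> N\<close> keeps the denominator \<open>S N\<close>
    away from 0 even where all bumps vanish; its decay makes the remainder vanish in the
    limit.\<close>
  define \<delta> :: "nat \<Rightarrow> real" where "\<delta> N = 1 / real (Suc N)" for N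
  define S where "S N x = \<delta> N + (\<Sum>i<N. g i x)" for N x
  define p where "p N j x = g j x / S N x" for N j x
  define r where "r N x = \<delta> N / S N x" for N x
  have cont\<phi>: "continuous_on UNIV \<phi>" using \<phi> by (simp add: bcontfun_def)
  have g0: "0 \<le> g j x" for j x by (simp add: g_def)
  have \<delta>0: "0 < \<delta> N" for N by (simp add: \<delta>_def)
  have S\<delta>: "\<delta> N \<le> S N x" for N x by (simp add: S_def g0 sum_nonneg)
  have S0: "0 < S N x" for N x using S\<delta> \<delta>0 by (meson less_le_trans)
  have gcont: "continuous_on UNIV (g j)" for j
    unfolding g_def by (intro continuous_intros cont\<phi>)
  have Scont: "continuous_on UNIV (S N)" for N
    unfolding S_def by (intro continuous_intros gcont)
  have gS: "g j x \<le> S N x" if "j < N" for j N x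
  proof -
    have "g j x \<le> (\<Sum>i<N. g i x)" using that g0 by (intro member_le_sum) auto
    thus ?thesis using \<delta>0[of N] by (simp add: S_def)
  qed
  have p0: "0 \<le> p N j x" for N j x by (simp add: p_def g0 S0 less_imp_le)
  have pb: "p N j \<in> bcontfun" if "j < N" for N j
  proof (rule bcontfun_normI)
    show "continuous_on UNIV (p N j)" unfolding p_def
      by (intro continuous_intros gcont Scont) (use S0 in \<open>auto simp: less_imp_neq[symmetric]\<close>)
    show "norm (p N j x) \<le> 1" for x using g0[of j x] gS[OF that, of x] S0[of N x] by (simp add: p_def)
  qed
  have r0: "0 \<le> r N x" for N x by (simp add: r_def \<delta>0 S0 less_imp_le)
  have r1: "r N x \<le> 1" for N x using S\<delta> S0 by (simp add: r_def)
  have rb: "r N \<in> bcontfun" for N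
  proof (rule bcontfun_normI)
    show "continuous_on UNIV (r N)" unfolding r_def
      by (intro continuous_intros Scont) (use S0 in \<open>auto simp: less_imp_neq[symmetric]\<close>)
    show "norm (r N x) \<le> 1" for x using r0[of N x] r1[of N x] by simp
  qed
  \<comment> \<open>By density some bump \<open>g j\<close> is positive at \<open>x\<close>. For
    \<open>N > j\<close> it is a summand of \<open>S N x\<close>, so \<open>r N x\<close> is at most
    \<open>\<delta> N / g j x\<close>.\<close>
  have rlim: "(\<lambda>N. r N x) \<longlonglongrightarrow> 0" for x
  proof -
    obtain d where d: "d \<in> D" "d \<in> ball (\<phi> x) \<epsilon>"
      using D(2)[of "ball (\<phi> x) \<epsilon>"] \<epsilon> by auto
    obtain j where "d = h j"
      unfolding h_def using from_nat_into_surj[OF D(1) d(1)] by auto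
    hence gj: "0 < g j x" using d by (simp add: g_def dist_norm)
    have "(\<lambda>N. \<delta> N / g j x) \<longlonglongrightarrow> 0 / g j x"
      using gj unfolding \<delta>_def
      by (intro tendsto_divide tendsto_const) (use LIMSEQ_inverse_real_of_nat in \<open>auto simp: field_simps\<close>)
    hence "(\<lambda>N. \<delta> N / g j x) \<longlonglongrightarrow> 0" by simp
    then show ?thesis
    proof (rule tendsto_sandwich[rotated 3])
      show "\<forall>\<^sub>F N in sequentially. r N x \<le> \<delta> N / g j x"
        using eventually_gt_at_top[of j]
      proof eventually_elim
        case (elim N)
        show ?case unfolding r_def
          using gS[OF elim, of x] gj \<delta>0[of N] S0[of N x] by (intro divide_left_mono) auto
      qed
    qed (auto simp: r0)
  qed
  have approx: "norm (\<phi> x - (\<Sum>j<N. p N j x *\<^sub>R h j)) \<le> \<epsilon> + norm (\<phi> x) * r N x" for N x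
  proof -
    have one: "r N x + (\<Sum>j<N. p N j x) = 1"
      using S0[of N x] by (simp add: r_def p_def sum_divide_distrib[symmetric] add_divide_distrib[symmetric] S_def)
    have "\<phi> x = (r N x + (\<Sum>j<N. p N j x)) *\<^sub>R \<phi> x" using one by simp
    also have "\<dots> = r N x *\<^sub>R \<phi> x + (\<Sum>j<N. p N j x *\<^sub>R \<phi> x)"
      by (simp add: scaleR_left_distrib scaleR_sum_left)
    \<comment> \<open>Writing 1 as remainder plus weights splits the error into the uncovered part
      of \<open>\<phi> x\<close> and a weighted sum of the distances to the
      \<open>h j\<close>.\<close>
    finally have "\<phi> x - (\<Sum>j<N. p N j x *\<^sub>R h j)
        = r N x *\<^sub>R \<phi> x + (\<Sum>j<N. p N j x *\<^sub>R (\<phi> x - h j))"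
      by (simp add: scaleR_right_diff_distrib sum_subtractf)
    also have "norm \<dots> \<le> norm (r N x *\<^sub>R \<phi> x) + (\<Sum>j<N. norm (p N j x *\<^sub>R (\<phi> x - h j)))"
      by (intro norm_triangle_le add_left_mono norm_sum)
    also have "\<dots> \<le> norm (\<phi> x) * r N x + (\<Sum>j<N. p N j x * \<epsilon>)"
    proof (intro add_mono sum_mono)
      show "norm (p N j x *\<^sub>R (\<phi> x - h j)) \<le> p N j x * \<epsilon>" for j
      \<comment> \<open>When the distance exceeds \<open>\<epsilon>\<close>, the weight is
        0.\<close>
      proof (cases "norm (\<phi> x - h j) \<le> \<epsilon>")
        case True
        then show ?thesis using mult_left_mono[OF True p0[of N j x]] p0[of N j x] by simp
      qed (simp add: p_def g_def)
    qed (use r0[of N x] in simp)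
    also have "(\<Sum>j<N. p N j x * \<epsilon>) \<le> 1 * \<epsilon>"
      unfolding sum_distrib_right[symmetric] using one r0[of N x] \<epsilon> by (intro mult_right_mono) auto
    finally show ?thesis by simp
  qed
  show ?thesis by (rule that[of p r h]) (fact pb rb r0 r1 rlim approx)+
qed

text \<open>The finite-rank part reduces to real test functions, and the error is controlled by the
  integral of \<open>r N\<close>, itself a real test function. A general filter \<open>F\<close>
  allows the lemma to be applied to neighbourhood filters of the weak topology.\<close>

lemma tendsto_integral_bcontfun:
  fixes \<phi> :: "'x::topological_space \<Rightarrow> 'h::{banach, second_countable_topology}"
  assumes \<mu>: "\<mu> \<in> borel_probs" and \<nu>: "\<forall>\<^sub>F i in F. \<nu> i \<in> borel_probs"
    and weak: "\<And>f :: 'x \<Rightarrow> real. f \<in> bcontfun \<Longrightarrow> ((\<lambda>i. \<integral>x. f x \<partial>\<nu> i) \<longlongrightarrow> (\<integral>x. f x \<partial>\<mu>)) F"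
    and \<phi>: "\<phi> \<in> bcontfun"
  shows "((\<lambda>i. \<integral>x. \<phi> x \<partial>\<nu> i) \<longlongrightarrow> (\<integral>x. \<phi> x \<partial>\<mu>)) F"
proof (rule tendstoI)
  fix e :: real assume "e > 0"
  \<comment> \<open>The two approximation errors cost less than \<open>2 * \<epsilon>\<close> each,
    and the finite-rank integrals differ by less than \<open>\<epsilon>\<close>.\<close>
  define \<epsilon> where "\<epsilon> = e / 5"
  have \<epsilon>: "\<epsilon> > 0" using \<open>e > 0\<close> by (simp add: \<epsilon>_def)
  obtain C where C: "C > 0" "\<And>x. norm (\<phi> x) \<le> C" using bcontfun_normE[OF \<phi>] by blast
  obtain h :: "nat \<Rightarrow> 'h" and p :: "nat \<Rightarrow> nat \<Rightarrow> 'x \<Rightarrow> real" and r :: "nat \<Rightarrow> 'x \<Rightarrow> real" where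
    p: "\<And>N j. j < N \<Longrightarrow> p N j \<in> bcontfun" and r: "\<And>N. r N \<in> bcontfun"
      "\<And>N x. 0 \<le> r N x" "\<And>N x. r N x \<le> 1" "\<And>x. (\<lambda>N. r N x) \<longlonglongrightarrow> 0"
    and approx: "\<And>N x. norm (\<phi> x - (\<Sum>j<N. p N j x *\<^sub>R h j)) \<le> \<epsilon> + norm (\<phi> x) * r N x"
    by (rule bcontfun_finite_rank_approximation[OF \<phi> \<epsilon>]) (rule that)
  interpret \<mu>: prob_space \<mu> using \<mu> by (simp add: borel_probs_def)
  \<comment> \<open>Dominated convergence under \<open>\<mu>\<close> alone fixes \<open>N\<close>
    before any \<open>\<nu> i\<close> is considered.\<close>
  have "(\<lambda>N. \<integral>x. r N x \<partial>\<mu>) \<longlonglongrightarrow> (\<integral>x. 0 \<partial>\<mu>)"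
  proof (rule integral_dominated_convergence[where w = "\<lambda>_. 1"])
    show "r N \<in> borel_measurable \<mu>" for N
      using integrable_bcontfun[OF r(1) \<mu>] by blast
  qed (use r in auto)
  hence "\<forall>\<^sub>F N in sequentially. (\<integral>x. r N x \<partial>\<mu>) < \<epsilon> / C"
    using \<epsilon> C by (intro order_tendstoD) auto
  then obtain N where N: "(\<integral>x. r N x \<partial>\<mu>) < \<epsilon> / C"
    by (auto simp: eventually_sequentially)
  \<comment> \<open>Stated for arbitrary \<open>\<kappa>\<close> since it serves both
    \<open>\<mu>\<close> and the \<open>\<nu> i\<close>, with the same \<open>N\<close>.\<close>
  have approx_integral: "norm ((\<integral>x. \<phi> x \<partial>\<kappa>) - (\<Sum>j<N. (\<integral>x. p N j x \<partial>\<kappa>) *\<^sub>R h j)) \<le> \<epsilon> + C * (\<integral>x. r N x \<partial>\<kappa>)"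
    if \<kappa>: "\<kappa> \<in> borel_probs" for \<kappa>
  proof -
    interpret \<kappa>: prob_space \<kappa> using \<kappa> by (simp add: borel_probs_def)
    have i\<phi>: "integrable \<kappa> \<phi>" and ir: "integrable \<kappa> (r N)" and ip: "\<And>j. j < N \<Longrightarrow> integrable \<kappa> (p N j)"
      using integrable_bcontfun \<phi> r(1) p \<kappa> by blast+
    have isum: "integrable \<kappa> (\<lambda>x. \<Sum>j<N. p N j x *\<^sub>R h j)"
      using ip by (intro Bochner_Integration.integrable_sum integrable_scaleR_left) auto
    have "(\<integral>x. \<phi> x \<partial>\<kappa>) - (\<Sum>j<N. (\<integral>x. p N j x \<partial>\<kappa>) *\<^sub>R h j)
        = (\<integral>x. \<phi> x - (\<Sum>j<N. p N j x *\<^sub>R h j) \<partial>\<kappa>)"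
      using i\<phi> isum ip by (subst Bochner_Integration.integral_diff)
        (auto simp: Bochner_Integration.integral_sum integral_scaleR_left)
    also have "norm \<dots> \<le> (\<integral>x. \<epsilon> + C * r N x \<partial>\<kappa>)"
    proof (rule order_trans[OF integral_norm_bound integral_mono])
      show "norm (\<phi> x - (\<Sum>j<N. p N j x *\<^sub>R h j)) \<le> \<epsilon> + C * r N x" for x
        using approx[of x N] mult_right_mono[OF C(2)[of x] r(2)[of N x]] by linarith
    qed (use i\<phi> isum ir in auto)
    also have "\<dots> = \<epsilon> + C * (\<integral>x. r N x \<partial>\<kappa>)"
      using ir by (subst Bochner_Integration.integral_add) (auto simp: \<kappa>.prob_space)
    finally show ?thesis .
  qed
  have "((\<lambda>i. \<Sum>j<N. (\<integral>x. p N j x \<partial>\<nu> i) *\<^sub>R h j) \<longlongrightarrow> (\<Sum>j<N. (\<integral>x. p N j x \<partial>\<mu>) *\<^sub>R h j)) F"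
    using weak p by (intro tendsto_intros) auto
  hence "\<forall>\<^sub>F i in F. dist (\<Sum>j<N. (\<integral>x. p N j x \<partial>\<nu> i) *\<^sub>R h j) (\<Sum>j<N. (\<integral>x. p N j x \<partial>\<mu>) *\<^sub>R h j) < \<epsilon>"
    using \<epsilon> by (rule tendstoD)
  \<comment> \<open>The strict bound under \<open>\<mu>\<close> passes to \<open>\<nu> i\<close>
    because \<open>r N\<close> is bounded and continuous.\<close>
  moreover have "\<forall>\<^sub>F i in F. (\<integral>x. r N x \<partial>\<nu> i) < \<epsilon> / C"
    using weak[OF r(1)] N by (rule order_tendstoD)
  ultimately show "\<forall>\<^sub>F i in F. dist (\<integral>x. \<phi> x \<partial>\<nu> i) (\<integral>x. \<phi> x \<partial>\<mu>) < e"
    using \<nu>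
  proof eventually_elim
    case (elim i)
    have "C * (\<integral>x. r N x \<partial>\<nu> i) < \<epsilon>" "C * (\<integral>x. r N x \<partial>\<mu>) < \<epsilon>"
      using elim(2) N C(1) by (auto simp: field_simps)
    then have "dist (\<integral>x. \<phi> x \<partial>\<nu> i) (\<Sum>j<N. (\<integral>x. p N j x \<partial>\<nu> i) *\<^sub>R h j) < 2 * \<epsilon>"
      "dist (\<integral>x. \<phi> x \<partial>\<mu>) (\<Sum>j<N. (\<integral>x. p N j x \<partial>\<mu>) *\<^sub>R h j) < 2 * \<epsilon>"
      using approx_integral[OF elim(3)] approx_integral[OF \<mu>] by (auto simp: dist_norm)
    then show ?case
      using elim(1) unfolding \<epsilon>_def by metric
  qed
qed

section \<open>The weak topology, continuity and measurability of integration\<close>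

lemma topspace_weak_topology [simp]:
  "topspace (weak_topology :: 'x::topological_space measure topology) = borel_probs"
proof -
  have "borel_probs \<in> {{\<mu> \<in> borel_probs. (\<integral>x. f x \<partial>\<mu>) \<in> U} | (f :: 'x \<Rightarrow> real) U. f \<in> bcontfun \<and> open U}"
    by (intro CollectI exI[of _ "\<lambda>_. 0"] exI[of _ UNIV]) (auto simp: const_bcontfun)
  then show ?thesis
    unfolding weak_topology_def topology_generated_by_topspace by blast
qed

lemma continuous_map_weak_topology_integral:
  fixes \<phi> :: "'x::topological_space \<Rightarrow> 'h::{banach, second_countable_topology}"
  assumes "\<phi> \<in> bcontfun"
  shows "continuous_map weak_topology euclidean (\<lambda>\<mu>. \<integral>x. \<phi> x \<partial>\<mu>)"
proof -
  \<comment> \<open>For real integrands the preimages of open sets are generators of the weak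
    topology. Vector-valued integrands are then handled pointwise along the filters
    \<open>atin\<close>.\<close>
  have real: "continuous_map weak_topology euclidean (\<lambda>\<mu>. \<integral>x. f x \<partial>\<mu>)" if "f \<in> bcontfun" for f :: "'x \<Rightarrow> real"
    unfolding continuous_map
  proof (intro conjI allI impI)
    fix U :: "real set" assume "openin euclidean U"
    then show "openin weak_topology {\<mu> \<in> topspace weak_topology. (\<integral>x. f x \<partial>\<mu>) \<in> U}"
      using that unfolding topspace_weak_topology
      unfolding weak_topology_def by (intro topology_generated_by_Basis) auto
  qed auto
  show ?thesis
    unfolding continuous_map_atin limitin_canonical_iff
  proof (rule ballI, rule tendsto_integral_bcontfun)
    fix \<mu> :: "'x measure" assume \<mu>: "\<mu> \<in> topspace weak_topology"
    then show "\<mu> \<in> borel_probs" by simp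
    show "\<forall>\<^sub>F \<nu> in atin weak_topology \<mu>. \<nu> \<in> borel_probs"
      unfolding eventually_atin using openin_topspace[of weak_topology] \<mu> by auto
    show "((\<lambda>\<nu>. \<integral>x. f x \<partial>\<nu>) \<longlongrightarrow> (\<integral>x. f x \<partial>\<mu>)) (atin weak_topology \<mu>)"
      if "f \<in> bcontfun" for f :: "'x \<Rightarrow> real"
      using real[OF that] \<mu> unfolding continuous_map_atin by simp
  qed (use assms in blast)
qed

lemma space_borel_of [simp]: "space (borel_of T) = topspace T"
  by (simp add: borel_of_def space_measure_of_conv)

lemma borel_of_openin: "openin T U \<Longrightarrow> U \<in> sets (borel_of T)"
  unfolding borel_of_def using openin_subset by (subst sets_measure_of) auto

lemma continuous_map_borel_measurable:
  fixes f :: "'a \<Rightarrow> 'b::topological_space"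
  assumes "continuous_map T euclidean f"
  shows "f \<in> borel_measurable (borel_of T)"
proof (rule borel_measurableI)
  fix U :: "'b set" assume "open U"
  then show "f -` U \<inter> space (borel_of T) \<in> sets (borel_of T)"
    using assms unfolding continuous_map_openin_preimage_eq
    by (intro borel_of_openin) (auto simp: Int_commute)
qed

lemma empirical_measure_borel_probs:
  assumes "n \<ge> 1"
  shows "empirical_measure n x \<in> borel_probs"
proof -
  have "prob_space (empirical_measure n x)"
  proof
    have "emeasure (empirical_measure n x) UNIV = of_nat n / of_nat n"
      by (subst emeasure_empirical_measure) auto
    also have "\<dots> = 1" using assms by (intro ennreal_divide_self) (auto simp: of_nat_less_top)
    finally show "emeasure (empirical_measure n x) (space (empirical_measure n x)) = 1" by simp
  qed
  then show ?thesis by (simp add: borel_probs_def)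
qed

text \<open>The metric enters through its topology: \<open>d\<close>-convergence is a limit in the
  weak topology, which the continuous integration map preserves.\<close>

lemma tendsto_integral_metrized:
  fixes \<phi> :: "'x::topological_space \<Rightarrow> 'h::{banach, second_countable_topology}"
  assumes d: "metrizes_weak_convergence d" and \<phi>: "\<phi> \<in> bcontfun" and \<mu>: "\<mu> \<in> borel_probs"
    and \<nu>: "\<forall>\<^sub>F i in F. \<nu> i \<in> borel_probs" and lim: "((\<lambda>i. d (\<nu> i) \<mu>) \<longlongrightarrow> 0) F"
  shows "((\<lambda>i. \<integral>x. \<phi> x \<partial>\<nu> i) \<longlongrightarrow> (\<integral>x. \<phi> x \<partial>\<mu>)) F"
proof -
  interpret Metric_space borel_probs d using d by (simp add: metrizes_weak_convergence_def)
  have "limitin mtopology \<nu> \<mu> F"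
    unfolding limitin_metric_dist_null using \<mu> \<nu> lim by blast
  then have "limitin weak_topology \<nu> \<mu> F"
    using d by (simp add: metrizes_weak_convergence_def)
  from continuous_map_limit[OF continuous_map_weak_topology_integral[OF \<phi>] this]
  show ?thesis by (simp add: o_def)
qed

section \<open>Convergence in measure, almost sure convergence and subsequences\<close>

text \<open>Truncation at 1 makes the \<open>D n\<close> integrable without changing whether they
  tend to 0. The truncations converge in L1, and an L1-null sequence has an almost surely null
  subsequence.\<close>

lemma (in finite_measure) in_measure_imp_AE_subseq:
  fixes D :: "nat \<Rightarrow> 'a \<Rightarrow> real"
  assumes [measurable]: "\<And>n. D n \<in> borel_measurable M" and pos: "\<And>n \<omega>. 0 \<le> D n \<omega>"
    and lim: "\<And>\<epsilon>. \<epsilon> > 0 \<Longrightarrow> (\<lambda>n. measure M {\<omega> \<in> space M. D n \<omega> > \<epsilon>}) \<longlonglongrightarrow> 0"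
  shows "\<exists>s :: nat \<Rightarrow> nat. strict_mono s \<and> (AE \<omega> in M. (\<lambda>n. D (s n) \<omega>) \<longlonglongrightarrow> 0)"
proof -
  let ?E = "\<lambda>n \<omega>. min 1 (D n \<omega>)"
  have int: "integrable M (?E n)" for n
    by (rule integrable_const_bound[where B = 1]) (use pos in auto)
  have "(\<lambda>n. \<integral>\<omega>. norm (?E n \<omega>) \<partial>M) \<longlonglongrightarrow> 0"
  proof (rule tendstoI)
    fix e :: real assume e: "e > 0"
    \<comment> \<open>Adding 1 keeps the later division meaningful when the total mass is 0.\<close>
    define K where "K = measure M (space M) + 1"
    have K: "K > 0" unfolding K_def by (smt (verit) measure_nonneg)
    define \<epsilon> where "\<epsilon> = e / (2 * K)"
    have \<epsilon>: "\<epsilon> > 0" using e K by (simp add: \<epsilon>_def)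
    have "\<epsilon> * measure M (space M) \<le> \<epsilon> * K" using \<epsilon> by (simp add: K_def)
    then have \<epsilon>K: "\<epsilon> * measure M (space M) \<le> e / 2" using K by (simp add: \<epsilon>_def)
    have "\<forall>\<^sub>F n in sequentially. measure M {\<omega> \<in> space M. D n \<omega> > \<epsilon>} < e / 2"
      using lim[OF \<epsilon>] e by (intro order_tendstoD) auto
    then show "\<forall>\<^sub>F n in sequentially. dist (\<integral>\<omega>. norm (?E n \<omega>) \<partial>M) 0 < e"
    proof eventually_elim
      case (elim n)
      let ?A = "{\<omega> \<in> space M. D n \<omega> > \<epsilon>}"
      have ind: "integrable M (indicator ?A :: 'a \<Rightarrow> real)"
        by (simp add: emeasure_eq_measure)
      \<comment> \<open>The truncation is at most \<open>\<epsilon>\<close> off \<open>?A\<close>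
        and at most 1 on it.\<close>
      have "(\<integral>\<omega>. norm (?E n \<omega>) \<partial>M) \<le> (\<integral>\<omega>. \<epsilon> + indicator ?A \<omega> \<partial>M)"
      proof (rule integral_mono)
        show "norm (?E n \<omega>) \<le> \<epsilon> + indicator ?A \<omega>" if "\<omega> \<in> space M" for \<omega>
          using pos[of n \<omega>] \<epsilon> that by (auto simp: indicator_def)
      qed (use int ind in auto)
      also have "\<dots> = \<epsilon> * measure M (space M) + measure M ?A"
        using ind by (subst Bochner_Integration.integral_add) auto
      finally have "(\<integral>\<omega>. norm (?E n \<omega>) \<partial>M) < e" using elim \<epsilon>K by linarith
      moreover have "0 \<le> (\<integral>\<omega>. norm (?E n \<omega>) \<partial>M)" by simp
      ultimately show ?case by (simp add: dist_real_def)
    qed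
  qed
  from tendsto_L1_AE_subseq[OF int this] obtain s :: "nat \<Rightarrow> nat" where
    s: "strict_mono s" "AE \<omega> in M. (\<lambda>n. ?E (s n) \<omega>) \<longlonglongrightarrow> 0" by blast
  from s(2) have "AE \<omega> in M. (\<lambda>n. D (s n) \<omega>) \<longlonglongrightarrow> 0"
  proof eventually_elim
    case (elim \<omega>)
    \<comment> \<open>Once below 1, the truncated value is the original one.\<close>
    then have "\<forall>\<^sub>F n in sequentially. ?E (s n) \<omega> < 1" by (rule order_tendstoD) simp
    then have "\<forall>\<^sub>F n in sequentially. ?E (s n) \<omega> = D (s n) \<omega>" by eventually_elim auto
    then show ?case using elim by (rule Lim_transform_eventually[rotated])
  qed
  with s(1) show ?thesis by blast
qed

text \<open>The indicators of the deviation events tend to 0 almost everywhere and are bounded by 1,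
  so dominated convergence applies.\<close>

lemma (in finite_measure) AE_imp_in_measure:
  fixes Z :: "nat \<Rightarrow> 'a \<Rightarrow> 'b::{metric_space, second_countable_topology}"
  assumes [measurable]: "\<And>n. Z n \<in> borel_measurable M" "Y \<in> borel_measurable M"
    and lim: "AE \<omega> in M. (\<lambda>n. Z n \<omega>) \<longlonglongrightarrow> Y \<omega>" and \<epsilon>: "\<epsilon> > 0"
  shows "(\<lambda>n. measure M {\<omega> \<in> space M. dist (Z n \<omega>) (Y \<omega>) > \<epsilon>}) \<longlonglongrightarrow> 0"
proof -
  let ?A = "\<lambda>n. {\<omega> \<in> space M. dist (Z n \<omega>) (Y \<omega>) > \<epsilon>}"
  have "(\<lambda>n. \<integral>\<omega>. indicator (?A n) \<omega> \<partial>M) \<longlonglongrightarrow> (\<integral>\<omega>. (0::real) \<partial>M)"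
  proof (rule integral_dominated_convergence[where w = "\<lambda>_. 1"])
    show "AE \<omega> in M. (\<lambda>n. indicator (?A n) \<omega> :: real) \<longlonglongrightarrow> 0"
      using lim
    proof eventually_elim
      case (elim \<omega>)
      have "\<forall>\<^sub>F n in sequentially. dist (Z n \<omega>) (Y \<omega>) < \<epsilon>" using elim \<epsilon> by (rule tendstoD)
      then have "\<forall>\<^sub>F n in sequentially. indicator (?A n) \<omega> = (0::real)"
        by eventually_elim (simp add: indicator_def)
      then show ?case by (rule tendsto_eventually)
    qed
  qed (auto simp: indicator_def)
  then show ?thesis by simp
qed

text \<open>If \<open>a\<close> does not tend to 0, it stays above some \<open>e > 0\<close> along a
  subsequence \<open>r\<close>, and then no reindexing of \<open>a\<close> along \<open>r\<close>
  tends to 0. The bound \<open>m\<close> allows initial indices to be skipped, such as the index 0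
  of an empirical measure.\<close>

lemma LIMSEQ_0_subseqI:
  fixes a :: "nat \<Rightarrow> real"
  assumes nn: "\<And>n. 0 \<le> a n"
    and sub: "\<And>r :: nat \<Rightarrow> nat. strict_mono r \<Longrightarrow> (\<And>k. m \<le> r k) \<Longrightarrow>
      \<exists>s :: nat \<Rightarrow> nat. (\<lambda>k. a (r (s k))) \<longlonglongrightarrow> 0"
  shows "a \<longlonglongrightarrow> 0"
proof (rule ccontr)
  assume "\<not> a \<longlonglongrightarrow> 0"
  then obtain e where e: "e > 0" "\<And>N. \<exists>n\<ge>N. a n \<ge> e"
    using nn by (auto simp: lim_sequentially dist_real_def not_less)
  have "infinite {n. n \<ge> m \<and> a n \<ge> e}"
    unfolding infinite_nat_iff_unbounded_le
  proof
    fix N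
    show "\<exists>n\<ge>N. n \<in> {n. n \<ge> m \<and> a n \<ge> e}" using e(2)[of "max N m"] by auto
  qed
  from infinite_enumerate[OF this] obtain r :: "nat \<Rightarrow> nat" where
    r: "strict_mono r" "\<And>k. m \<le> r k" "\<And>k. e \<le> a (r k)" by auto
  from sub[OF r(1,2)] obtain s :: "nat \<Rightarrow> nat" where "(\<lambda>k. a (r (s k))) \<longlonglongrightarrow> 0" by blast
  from tendsto_lowerbound[OF this, of e] r(3) e(1) show False by simp
qed

section \<open>Convergence of the empirical integrals in both modes\<close>

theorem theorem3p6:
  fixes M :: "'w measure"
    and X :: "nat \<Rightarrow> 'w \<Rightarrow> 'x::polish_space"
    and P :: "'w \<Rightarrow> 'x measure"
    and d :: "'x measure \<Rightarrow> 'x measure \<Rightarrow> real"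
  assumes "complete_standard_borel_prob_space M"
    and "locally_compact_space (euclidean :: 'x topology)"
    and "\<forall>n\<ge>1. X n \<in> borel_measurable M"
    and "metrizes_weak_convergence d"
  shows "(limit_measure_in_prob M d X P \<longrightarrow>
            (\<forall>\<phi> :: 'x \<Rightarrow> 'h::{real_inner, banach, second_countable_topology}. \<phi> \<in> bcontfun \<longrightarrow>
              converges_in_prob M (\<lambda>n \<omega>. \<integral>x. \<phi> x \<partial>empirical_measure n (\<lambda>i. X i \<omega>))
                (\<lambda>\<omega>. \<integral>x. \<phi> x \<partial>P \<omega>))) \<and>
         (limit_measure_AE M d X P \<longrightarrow>
            (\<forall>\<phi> :: 'x \<Rightarrow> 'h. \<phi> \<in> bcontfun \<longrightarrow>
              (AE \<omega> in M. (\<lambda>n. \<integral>x. \<phi> x \<partial>empirical_measure n (\<lambda>i. X i \<omega>))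
                \<longlonglongrightarrow> (\<integral>x. \<phi> x \<partial>P \<omega>))))"
proof -
  obtain N where "prob_space N" "M = completion N"
    using assms(1) unfolding complete_standard_borel_prob_space_def by blast
  then interpret prob_space M by (simp add: prob_space.prob_space_completion)
  interpret d: Metric_space borel_probs d using assms(4) by (simp add: metrizes_weak_convergence_def)
  let ?\<eta> = "\<lambda>n \<omega>. empirical_measure n (\<lambda>i. X i \<omega>)"
  have P_probs: "P \<omega> \<in> borel_probs" if "random_measure M P" "\<omega> \<in> space M" for \<omega>
    using measurable_space[of P M "borel_of weak_topology"] that by (simp add: random_measure_def)
  \<comment> \<open>The continuous mapping argument for one fixed \<open>\<omega>\<close>. The index
    map \<open>u\<close> is the identity in the almost sure case and a subsequence in the other; it
    must eventually avoid 0, where the empirical measure is not a probability measure.\<close>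
  have lim: "(\<lambda>k. \<integral>x. \<phi> x \<partial>?\<eta> (u k) \<omega>) \<longlonglongrightarrow> (\<integral>x. \<phi> x \<partial>P \<omega>)"
    if "random_measure M P" "\<omega> \<in> space M" "\<phi> \<in> bcontfun" "\<forall>\<^sub>F k in sequentially. 1 \<le> u k"
      "(\<lambda>k. d (?\<eta> (u k) \<omega>) (P \<omega>)) \<longlonglongrightarrow> 0" for \<omega> u and \<phi> :: "'x \<Rightarrow> 'h"
    using that(4) by (intro tendsto_integral_metrized[OF assms(4) that(3)] P_probs that)
      (auto elim!: eventually_mono intro: empirical_measure_borel_probs)
  have in_prob: "converges_in_prob M (\<lambda>n \<omega>. \<integral>x. \<phi> x \<partial>?\<eta> n \<omega>) (\<lambda>\<omega>. \<integral>x. \<phi> x \<partial>P \<omega>)"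
    if L: "limit_measure_in_prob M d X P" and \<phi>: "\<phi> \<in> bcontfun" for \<phi> :: "'x \<Rightarrow> 'h"
  proof -
    let ?Z = "\<lambda>n \<omega>. \<integral>x. \<phi> x \<partial>?\<eta> n \<omega>" and ?Y = "\<lambda>\<omega>. \<integral>x. \<phi> x \<partial>P \<omega>" and ?D = "\<lambda>n \<omega>. d (?\<eta> n \<omega>) (P \<omega>)"
    have rm: "random_measure M P" and D: "\<And>n. 1 \<le> n \<Longrightarrow> ?D n \<in> borel_measurable M"
      and Dlim: "\<And>\<epsilon>. \<epsilon> > 0 \<Longrightarrow> (\<lambda>n. prob {\<omega> \<in> space M. ?D n \<omega> > \<epsilon>}) \<longlonglongrightarrow> 0"
      using L by (auto simp: limit_measure_in_prob_def converges_in_prob_def)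
    have \<phi>m [measurable]: "\<phi> \<in> borel_measurable borel" by (rule bcontfun_borel_measurable[OF \<phi>])
    \<comment> \<open>The integral is a finite average of the measurable maps
      \<open>\<phi> (X i \<omega>)\<close>.\<close>
    have Z: "?Z n \<in> borel_measurable M" if n: "1 \<le> n" for n
    proof -
      have [measurable]: "X i \<in> borel_measurable M" if "i \<in> {1..n}" for i using assms(3) that by simp
      have "?Z n = (\<lambda>\<omega>. (1 / real n) *\<^sub>R (\<Sum>i=1..n. \<phi> (X i \<omega>)))"
        using integral_empirical_measure[OF n \<phi>m] by auto
      also have "\<dots> \<in> borel_measurable M" by measurable
      finally show ?thesis .
    qed
    \<comment> \<open>Integration of \<open>\<phi>\<close> is weakly continuous, hence Borel, and is
      composed with the random measure \<open>P\<close>.\<close>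
    have Y: "?Y \<in> borel_measurable M"
      using measurable_compose[OF _ continuous_map_borel_measurable[OF continuous_map_weak_topology_integral[OF \<phi>]]]
        rm by (simp add: random_measure_def)
    have "(\<lambda>n. prob {\<omega> \<in> space M. dist (?Z n \<omega>) (?Y \<omega>) > \<epsilon>}) \<longlonglongrightarrow> 0" if "\<epsilon> > 0" for \<epsilon>
    \<comment> \<open>Every subsequence of distances has a further one that vanishes almost surely.
      Along it the integrals converge almost surely, hence in probability. Taking
      \<open>m = 1\<close> keeps all indices in the range where measurability is known.\<close>
    proof (rule LIMSEQ_0_subseqI[where m = 1])
      fix r :: "nat \<Rightarrow> nat" assume r: "strict_mono r" "\<And>k. 1 \<le> r k"
      have "(\<lambda>k. prob {\<omega> \<in> space M. ?D (r k) \<omega> > \<epsilon>}) \<longlonglongrightarrow> 0" if "\<epsilon> > 0" for \<epsilon>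
        using LIMSEQ_subseq_LIMSEQ[OF Dlim[OF that] r(1)] by (simp add: o_def)
      then obtain s :: "nat \<Rightarrow> nat" where "AE \<omega> in M. (\<lambda>k. ?D (r (s k)) \<omega>) \<longlonglongrightarrow> 0"
        using in_measure_imp_AE_subseq[of "\<lambda>k. ?D (r k)"] D r(2) by auto
      then have "AE \<omega> in M. (\<lambda>k. ?Z (r (s k)) \<omega>) \<longlonglongrightarrow> ?Y \<omega>"
        using AE_space by eventually_elim (auto intro!: lim rm \<phi> simp: r(2)[simplified])
      from AE_imp_in_measure[OF _ Y this \<open>\<epsilon> > 0\<close>] Z r(2)
      show "\<exists>s :: nat \<Rightarrow> nat. (\<lambda>k. prob {\<omega> \<in> space M. dist (?Z (r (s k)) \<omega>) (?Y \<omega>) > \<epsilon>}) \<longlonglongrightarrow> 0"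
        by blast
    qed simp
    with Z Y show ?thesis by (simp add: converges_in_prob_def)
  qed
  have AE: "AE \<omega> in M. (\<lambda>n. \<integral>x. \<phi> x \<partial>?\<eta> n \<omega>) \<longlonglongrightarrow> (\<integral>x. \<phi> x \<partial>P \<omega>)"
    if L: "limit_measure_AE M d X P" and \<phi>: "\<phi> \<in> bcontfun" for \<phi> :: "'x \<Rightarrow> 'h"
  proof -
    have rm: "random_measure M P" and "AE \<omega> in M. (\<lambda>n. d (?\<eta> n \<omega>) (P \<omega>)) \<longlonglongrightarrow> 0"
      using L by (auto simp: limit_measure_AE_def)
    from this(2) show ?thesis
      using AE_space by eventually_elim (intro lim rm \<phi> eventually_ge_at_top)
  qed
  show ?thesis using in_prob AE by blast
qed

end
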